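(* For every integer $n\ge 2$, there exists a common subsequence of $\mathbf{t}_n$ and $\overline{\mathbf{t}}_n$ of length at least $n\left(1-\frac{1}{\lfloor\log_2(n)\rfloor/16}\right)$.
   Context: The Thue–Morse sequence $\mathbf{t}=t_0t_1t_2\cdots$ is the infinite binary sequence with $t_i$ equal to the parity of the number of $1$'s in the binary representation of $i$ (equivalently, the fixed point starting with $0$ of the morphism $0\mapsto 01$, $1\mapsto 10$). $\mathbf{t}_n$ is its prefix of length $n$, and $\overline{\mathbf{t}}_n$ is the bitwise complement of $\mathbf{t}_n$ (swap $0$ and $1$). A common subsequence of two words is a word that is a (not necessarily contiguous) subsequence of both. *)

theory Defs
  imports Complex_Main "HOL-Library.Sublist"
begin

text \<open>Binary letters are booleans, with \<^const>\<open>False\<close> for 0 and \<^const>\<open>True\<close> for 1.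
  The set of one-bits of a natural number is finite, so \<^const>\<open>card\<close> really counts them.\<close>

definition thue_morse :: "nat \<Rightarrow> bool" where
  "thue_morse i \<longleftrightarrow> odd (card {k. bit i k})"

definition tm_prefix :: "nat \<Rightarrow> bool list" where
  "tm_prefix n = map thue_morse [0..<n]"

definition complement_word :: "bool list \<Rightarrow> bool list" where
  "complement_word w = map Not w"

definition common_subseq :: "'a list \<Rightarrow> 'a list \<Rightarrow> 'a list \<Rightarrow> bool" where
  "common_subseq w u v \<longleftrightarrow> subseq w u \<and> subseq w v"

end

theory Submission
  imports Defs
begin

text \<open>Cut both words into blocks of length \<open>2 ^ k\<close> and match block \<open>m + 1\<close> of the
  Thue--Morse word with block \<open>m\<close> of its complement. The two blocks are identical when
  \<open>t\<^bsub>m+1\<^esub> \<noteq> t\<^bsub>m\<^esub>\<close>, in particular for all even \<open>m\<close>; otherwise they are \<open>t\<close> and its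
  complement at length \<open>2 ^ k\<close>, and a common subsequence for that length is used.
  If \<open>f k\<close> is the fraction of letters lost at length \<open>2 ^ k\<close>, the fraction lost at length
  \<open>n \<ge> 2 ^ K\<close> is thus at most \<open>2 / 2 ^ (K - k) + f k / 2\<close>. Taking \<open>K - k = K div 4\<close>, the bound
  \<open>16 / K\<close> propagates by induction on \<open>K\<close>; it is trivial for \<open>K \<le> 16\<close>.\<close>

section \<open>Recursion of the Thue--Morse sequence in binary digits\<close>

lemma finite_bits_nat: "finite {k. bit (n::nat) k}"
proof (rule finite_subset)
  show "{k. bit n k} \<subseteq> {..<n}"
  proof
    fix k assume "k \<in> {k. bit n k}"
    then have "n div 2 ^ k \<noteq> 0" by (auto simp: bit_iff_odd intro: ccontr)
    then have "2 ^ k \<le> n" by (metis div_less not_less)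
    then show "k \<in> {..<n}" using less_exp[of k] by (simp only: lessThan_iff)
  qed
qed simp

lemma thue_morse_double: "thue_morse (2 * n) = thue_morse n"
proof -
  have "{k. bit (2 * n) k} = Suc ` {k. bit n k}"
    by (auto simp: bit_0 bit_Suc image_iff) (metis bit_0 bit_Suc dvd_triv_left nat.exhaust
        nonzero_mult_div_cancel_left zero_neq_numeral)
  then show ?thesis by (simp add: thue_morse_def card_image)
qed

lemma thue_morse_Suc_double: "thue_morse (Suc (2 * n)) \<longleftrightarrow> \<not> thue_morse n"
proof -
  have "bit (Suc (2 * n)) k \<longleftrightarrow> k \<in> insert 0 (Suc ` {k. bit n k})" for k
    by (cases k) (auto simp: bit_0 bit_Suc)
  then have "{k. bit (Suc (2 * n)) k} = insert 0 (Suc ` {k. bit n k})" by blast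
  then show ?thesis by (simp add: thue_morse_def card_image finite_bits_nat)
qed

lemma thue_morse_0: "\<not> thue_morse 0"
  by (simp add: thue_morse_def)

text \<open>The binary digits of \<open>i * 2 ^ k + r\<close> are those of \<open>i\<close> followed
  by those of \<open>r\<close>, padded to \<open>k\<close> digits, so the parities add. The
  induction strips the last digit.\<close>

lemma thue_morse_block:
  "r < 2 ^ k \<Longrightarrow> thue_morse (i * 2 ^ k + r) \<longleftrightarrow> (thue_morse i \<noteq> thue_morse r)"
proof (induction k arbitrary: r)
  case 0
  then show ?case by (simp add: thue_morse_0)
next
  case (Suc k)
  have IH: "thue_morse (i * 2 ^ k + r div 2) \<longleftrightarrow> (thue_morse i \<noteq> thue_morse (r div 2))"
    using Suc.prems by (intro Suc.IH) simp
  show ?case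
  proof (cases "even r")
    case True
    then obtain s where "r = 2 * s" ..
    then show ?thesis
      using IH thue_morse_double[of "i * 2 ^ k + s"] thue_morse_double[of s]
      by (simp add: algebra_simps)
  next
    case False
    then obtain s where "r = Suc (2 * s)" by (metis oddE Suc_eq_plus1)
    then show ?thesis
      using IH thue_morse_Suc_double[of "i * 2 ^ k + s"] thue_morse_Suc_double[of s]
      by (simp add: algebra_simps)
  qed
qed

section \<open>Matching blocks after a shift by one block\<close>

definition tm_block :: "nat \<Rightarrow> nat \<Rightarrow> bool list" where
  "tm_block k i = map thue_morse [i * 2 ^ k..<Suc i * 2 ^ k]"

lemma tm_block_eq:
  "tm_block k i =
    (if thue_morse i then complement_word (tm_prefix (2 ^ k)) else tm_prefix (2 ^ k))"
  by (rule nth_equalityI)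
    (auto simp: tm_block_def tm_prefix_def complement_word_def thue_morse_block)

lemma complement_word_complement_word [simp]: "complement_word (complement_word w) = w"
  by (simp add: complement_word_def comp_def)

lemma complement_word_append: "complement_word (u @ v) = complement_word u @ complement_word v"
  by (simp add: complement_word_def)

lemma length_complement_word [simp]: "length (complement_word w) = length w"
  by (simp add: complement_word_def)

lemma length_tm_prefix [simp]: "length (tm_prefix n) = n"
  by (simp add: tm_prefix_def)

lemma common_subseq_append:
  "common_subseq w u v \<Longrightarrow> common_subseq w' u' v' \<Longrightarrow> common_subseq (w @ w') (u @ u') (v @ v')"
  by (simp add: common_subseq_def list_emb_append_mono)

lemma common_subseq_commute: "common_subseq w u v \<longleftrightarrow> common_subseq w v u"
  by (auto simp: common_subseq_def)

text \<open>The loss of \<open>w\<close> is charged to every odd \<open>m\<close>, even where the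
  two blocks coincide; this overcount makes the total over many blocks easy to sum.\<close>

lemma common_subseq_shifted_blocks:
  assumes "common_subseq w (tm_prefix (2 ^ k)) (complement_word (tm_prefix (2 ^ k)))"
  shows "\<exists>x. common_subseq x (tm_block k (Suc m)) (complement_word (tm_block k m)) \<and>
    2 ^ k \<le> length x + of_bool (odd m) * (2 ^ k - length w)"
proof (cases "thue_morse (Suc m) = thue_morse m")
  case True
  \<comment> \<open>For \<open>m = 2 * i\<close> the two letters are \<open>thue_morse i\<close> and
    its negation, hence different.\<close>
  then have "odd m"
    using thue_morse_double thue_morse_Suc_double by (metis evenE)
  \<comment> \<open>If both letters are 1, prefix and complement swap roles, so symmetry is
    needed.\<close>
  moreover have "common_subseq w (tm_block k (Suc m)) (complement_word (tm_block k m))"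
    using True assms by (auto simp: tm_block_eq common_subseq_commute)
  ultimately show ?thesis by (intro exI[of _ w]) simp
next
  case False
  then have "tm_block k (Suc m) = complement_word (tm_block k m)"
    by (auto simp: tm_block_eq)
  then show ?thesis
    by (intro exI[of _ "tm_block k (Suc m)"]) (simp add: common_subseq_def tm_block_def)
qed

text \<open>Concatenating the matches of the first \<open>m\<close> block pairs works;
  \<open>m div 2\<close> counts the odd indices below \<open>m\<close>.\<close>

lemma common_subseq_shifted:
  assumes "common_subseq w (tm_prefix (2 ^ k)) (complement_word (tm_prefix (2 ^ k)))"
  shows "\<exists>x. common_subseq x (map thue_morse [2 ^ k..<Suc m * 2 ^ k])
      (complement_word (tm_prefix (m * 2 ^ k))) \<and>
    m * 2 ^ k \<le> length x + (m div 2) * (2 ^ k - length w)"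
proof (induction m)
  case 0
  show ?case by (intro exI[of _ "[]"]) (simp add: common_subseq_def)
next
  case (Suc m)
  obtain x where x: "common_subseq x (map thue_morse [2 ^ k..<Suc m * 2 ^ k])
      (complement_word (tm_prefix (m * 2 ^ k)))"
    "m * 2 ^ k \<le> length x + (m div 2) * (2 ^ k - length w)"
    using Suc.IH by blast
  obtain y where y: "common_subseq y (tm_block k (Suc m)) (complement_word (tm_block k m))"
    "2 ^ k \<le> length y + of_bool (odd m) * (2 ^ k - length w)"
    using common_subseq_shifted_blocks[OF assms] by blast
  have append: "map thue_morse [i..<Suc j * 2 ^ k] = map thue_morse [i..<j * 2 ^ k] @ tm_block k j"
    if "i \<le> j * 2 ^ k" for i j
    using upt_add_eq_append[OF that, of "2 ^ k"]
    by (simp add: tm_block_def add.commute flip: map_append)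
  have "common_subseq (x @ y) (map thue_morse [2 ^ k..<Suc (Suc m) * 2 ^ k])
      (complement_word (tm_prefix (Suc m * 2 ^ k)))"
    using common_subseq_append[OF x(1) y(1)] append[of "2 ^ k" "Suc m"] append[of 0 m]
    by (simp add: tm_prefix_def flip: complement_word_append)
  moreover have "Suc m div 2 = m div 2 + of_bool (odd m)" by (cases "even m") auto
  then have "Suc m * 2 ^ k \<le> length (x @ y) + (Suc m div 2) * (2 ^ k - length w)"
    using x(2) y(2) by (simp add: add_mult_distrib)
  ultimately show ?case by blast
qed

lemma tm_prefix_append: "i \<le> j \<Longrightarrow> tm_prefix j = tm_prefix i @ map thue_morse [i..<j]"
  using upt_add_eq_append[of 0 i "j - i"] by (simp add: tm_prefix_def flip: map_append)

text \<open>The inequality is the bound on lost letters multiplied by \<open>2 * 2 ^ k\<close>,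
  which avoids division in the natural numbers.\<close>

lemma common_subseq_tm_prefix:
  assumes "common_subseq w (tm_prefix (2 ^ k)) (complement_word (tm_prefix (2 ^ k)))"
    and "2 ^ k \<le> n"
  shows "\<exists>x. common_subseq x (tm_prefix n) (complement_word (tm_prefix n)) \<and>
    2 * n * 2 ^ k \<le> 2 * length x * 2 ^ k + 4 * 2 ^ k * 2 ^ k + n * (2 ^ k - length w)"
proof -
  define q where "q = n div 2 ^ k"
  \<comment> \<open>Of the \<open>q\<close> full blocks the shift leaves one unmatched in each
    word.\<close>
  define m where "m = q - 1"
  have "q > 0" using assms(2) by (simp add: q_def div_greater_zero_iff)
  then have q: "q = Suc m" by (simp add: m_def)
  have n: "q * 2 ^ k \<le> n" "n \<le> q * 2 ^ k + 2 ^ k"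
    using div_mult_mod_eq[of n "2 ^ k"] mod_less_divisor[of "2 ^ k" n]
    by (simp_all add: q_def del: mod_less_divisor)
  obtain x where x: "common_subseq x (map thue_morse [2 ^ k..<Suc m * 2 ^ k])
      (complement_word (tm_prefix (m * 2 ^ k)))"
    "m * 2 ^ k \<le> length x + (m div 2) * (2 ^ k - length w)"
    using common_subseq_shifted[OF assms(1)] by blast
  have "subseq x (tm_prefix (q * 2 ^ k))"
    using x(1) tm_prefix_append[of "2 ^ k" "q * 2 ^ k"]
    by (simp add: q common_subseq_def list_emb_append2)
  then have 1: "subseq x (tm_prefix n)"
    using tm_prefix_append[OF n(1)] by (simp add: subseq_rev_drop_many)
  have "m * 2 ^ k \<le> n" using n(1) q by simp
  from tm_prefix_append[OF this] have 2: "subseq x (complement_word (tm_prefix n))"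
    using x(1) by (simp add: complement_word_append common_subseq_def subseq_rev_drop_many)
  have "2 * ((m div 2) * (2 ^ k - length w)) * 2 ^ k = (2 * (m div 2) * 2 ^ k) * (2 ^ k - length w)"
    by simp
  also have "\<dots> \<le> n * (2 ^ k - length w)"
  proof (rule mult_right_mono)
    have "2 * (m div 2) * 2 ^ k \<le> m * 2 ^ k" by (rule mult_right_mono) auto
    with \<open>m * 2 ^ k \<le> n\<close> show "2 * (m div 2) * 2 ^ k \<le> n" by linarith
  qed simp
  finally have 3: "2 * ((m div 2) * (2 ^ k - length w)) * 2 ^ k \<le> n * (2 ^ k - length w)" .
  \<comment> \<open>One \<open>2 ^ k\<close> pays for the block lost by the shift, the other for the
    incomplete block at the end.\<close>
  have "n \<le> length x + (m div 2) * (2 ^ k - length w) + 2 * 2 ^ k"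
    using n(2) x(2) q by simp
  then have "n * (2 * 2 ^ k) \<le> (length x + (m div 2) * (2 ^ k - length w) + 2 * 2 ^ k) * (2 * 2 ^ k)"
    by (rule mult_right_mono) simp
  then have "2 * n * 2 ^ k \<le> 2 * length x * 2 ^ k + 4 * 2 ^ k * 2 ^ k + n * (2 ^ k - length w)"
    using 3 by (simp add: algebra_simps)
  with 1 2 show ?thesis by (auto simp: common_subseq_def)
qed

section \<open>Induction on the exponent\<close>

text \<open>Here \<open>n - l\<close> and \<open>d\<close> are the losses at lengths
  \<open>n\<close> and \<open>2 ^ k\<close>. The relative loss at \<open>n\<close> is at most
  \<open>2 / 2 ^ j + 8 / k\<close>; times \<open>K\<close>, the two terms are at most 16/3 and 32/3,
  which sum to 16.\<close>

lemma loss_recurrence: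
  fixes n l d :: real and K k j :: nat
  assumes "2 ^ K \<le> n" and "16 < K" and "j = K div 4" and "k = K - j"
    and "0 \<le> d" and d: "k * d \<le> 16 * 2 ^ k"
    and l: "2 * n * 2 ^ k \<le> 2 * l * 2 ^ k + 4 * 2 ^ k * 2 ^ k + n * d"
  shows "K * (n - l) \<le> 16 * n"
proof -
  have K: "K = k + j" "K \<le> 4 * j + 3" "3 * K \<le> 4 * k" "j \<ge> 4" using assms(2-4) by linarith+
  \<comment> \<open>Tripling \<open>K \<le> 4 * j + 3\<close> gives the left-hand side at
    \<open>i = j\<close>.\<close>
  have "12 * i + 9 \<le> 8 * 2 ^ i" if "i \<ge> 4" for i :: nat
    using that by (induction i rule: dec_induct) auto
  from this[OF \<open>j \<ge> 4\<close>] have "3 * K \<le> 8 * 2 ^ j" using K(2) by linarith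
  then have "real (3 * K) \<le> real (8 * 2 ^ j)" by (rule of_nat_mono)
  then have j: "3 * real K \<le> 8 * 2 ^ j" by simp
  have n: "2 ^ k * 2 ^ j \<le> n" using assms(1) K(1) by (simp add: power_add)
  have "n > 0" by (rule less_le_trans[OF _ assms(1)]) simp
  have Kk: "3 * (real K * 2 ^ k) \<le> 8 * n"
  proof -
    have "3 * real K * 2 ^ k \<le> 8 * 2 ^ j * 2 ^ k" by (rule mult_right_mono[OF j]) simp
    also have "\<dots> \<le> 8 * n" using n by (simp add: mult.commute)
    finally show ?thesis by (simp only: mult.assoc)
  qed
  have Kd: "3 * (K * d) \<le> 64 * 2 ^ k"
  proof -
    have "3 * real K \<le> 4 * real k" using K(3) by linarith
    from mult_right_mono[OF this \<open>0 \<le> d\<close>] d show ?thesis by simp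
  qed
  have "2 * n - 2 * l \<le> 4 * 2 ^ k + n * d / 2 ^ k"
    using l by (simp add: field_simps)
  then have "3 * real K * (2 * n - 2 * l) \<le> 3 * real K * (4 * 2 ^ k + n * d / 2 ^ k)"
    by (intro mult_left_mono) auto
  also have "\<dots> = 4 * (3 * (real K * 2 ^ k)) + n * (3 * (K * d)) / 2 ^ k"
    by (simp add: algebra_simps)
  also have "n * (3 * (K * d)) / 2 ^ k \<le> 64 * n"
    using mult_left_mono[OF Kd, of n] \<open>n > 0\<close> by (simp add: field_simps)
  \<comment> \<open>The terms contribute \<open>32 * n\<close> and \<open>64 * n\<close>, in total 6
    times \<open>16 * n\<close>.\<close>
  finally show ?thesis using Kk by (simp add: algebra_simps)
qed

text \<open>Induction runs over the exponent with \<open>n\<close> arbitrary, so that the hypothesis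
  for \<open>k < K\<close> can be applied to the block length \<open>2 ^ k\<close> itself.\<close>

lemma common_subseq_tm_prefix_exp:
  assumes "2 ^ K \<le> n"
  shows "\<exists>x. common_subseq x (tm_prefix n) (complement_word (tm_prefix n)) \<and>
    K * (real n - length x) \<le> 16 * real n"
  using assms
proof (induction K arbitrary: n rule: less_induct)
  case (less K)
  show ?case
  proof (cases "K \<le> 16")
    case True
    then show ?thesis
      by (intro exI[of _ "[]"]) (simp add: common_subseq_def mult_right_mono)
  next
    case False
    define j where "j = K div 4"
    define k where "k = K - j"
    have "k < K" using False by (simp add: k_def j_def)
    then obtain w where w: "common_subseq w (tm_prefix (2 ^ k)) (complement_word (tm_prefix (2 ^ k)))"
      "k * (2 ^ k - real (length w)) \<le> 16 * 2 ^ k"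
      using less.IH[of k "2 ^ k"] by auto
    \<comment> \<open>This makes the truncated subtraction agree with the real one.\<close>
    have "length w \<le> 2 ^ k"
      using w(1) list_emb_length by (fastforce simp: common_subseq_def)
    then have d: "real (2 ^ k - length w) = 2 ^ k - real (length w)" by simp
    have "(2::nat) ^ k \<le> 2 ^ K" using \<open>k < K\<close> by simp
    with less.prems have "2 ^ k \<le> n" by linarith
    from common_subseq_tm_prefix[OF w(1) this]
    obtain x where x: "common_subseq x (tm_prefix n) (complement_word (tm_prefix n))"
      "2 * n * 2 ^ k \<le> 2 * length x * 2 ^ k + 4 * 2 ^ k * 2 ^ k + n * (2 ^ k - length w)"
      by blast
    have "real (2 * n * 2 ^ k) \<le>
        real (2 * length x * 2 ^ k + 4 * 2 ^ k * 2 ^ k + n * (2 ^ k - length w))"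
      using x(2) by (rule of_nat_mono)
    then have "2 * real n * 2 ^ k \<le>
        2 * real (length x) * 2 ^ k + 4 * 2 ^ k * 2 ^ k + real n * (2 ^ k - real (length w))"
      by (simp add: d)
    moreover have "2 ^ K \<le> real n" using less.prems by (metis of_nat_le_iff of_nat_numeral of_nat_power)
    ultimately have "K * (real n - length x) \<le> 16 * real n"
      using loss_recurrence[OF _ _ j_def k_def _ w(2)] False \<open>length w \<le> 2 ^ k\<close> by simp
    with x(1) show ?thesis by blast
  qed
qed

theorem theorem3:
  fixes n :: nat
  assumes "n \<ge> 2"
  shows "\<exists>w. common_subseq w (tm_prefix n) (complement_word (tm_prefix n)) \<and>
           real (length w) \<ge> real n * (1 - 1 / (real_of_int \<lfloor>log 2 (real n)\<rfloor> / 16))"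
proof -
  \<comment> \<open>\<open>K\<close> satisfies \<open>2 ^ K \<le> n\<close>, and
    \<open>n \<ge> 2\<close> makes it positive, so the final bound can be divided by
    \<open>K\<close>.\<close>
  define K where "K = nat \<lfloor>log 2 (real n)\<rfloor>"
  have "1 \<le> log 2 (real n)" using assms by simp
  then have floor: "\<lfloor>log 2 (real n)\<rfloor> = int K" and "K > 0" by (simp_all add: K_def le_floor_iff)
  have "real K \<le> log 2 (real n)" using floor by linarith
  then have "2 ^ K \<le> real n" using assms by (simp add: le_log_iff powr_realpow)
  then have "2 ^ K \<le> n" by (metis of_nat_le_iff of_nat_numeral of_nat_power)
  then obtain w where "common_subseq w (tm_prefix n) (complement_word (tm_prefix n))"
    "K * (real n - length w) \<le> 16 * real n"
    using common_subseq_tm_prefix_exp by blast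
  with \<open>K > 0\<close> show ?thesis
    by (intro exI[of _ w]) (simp add: floor field_simps)
qed

end
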